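(* Let $\mathbb{T}$ be the (finite, non-empty) set of computation trees of depth $L$ of a graph $\mathcal{G}$, one tree $\mathcal{T}_v^L$ per node $v$, and let $k$ be a positive integer. Let $\theta>0$ be an error bound and $\delta\in(0,1)$. Let $\mathbb{S}$ be a sample of $|\mathbb{S}|$ trees drawn independently and uniformly at random from $\mathbb{T}$, where $$|\mathbb{S}|\;\ge\; \frac{\ln\left(\frac{2}{\delta}\right)(2+\theta)}{\theta^2}.$$ Then for any $\mathcal{T}_v^L\in\mathbb{T}$, $$P\left(\left|\widetilde{\Pi}(\mathcal{T}_v^L)-\Pi(\mathcal{T}_v^L)\right|\le\theta\right)\ge 1-\delta .$$
   Context: A graph $\mathcal{G}=(\mathcal{V},\mathcal{E},\boldsymbol{X})$ has a finite non-empty node set $\mathcal{V}$, edge set $\mathcal{E}$, and a real feature vector $\mathbf{x}_v$ for each node $v$. For an integer $L\ge 1$, the computation tree $\mathcal{T}_v^L$ rooted at $v$ is obtained by enumerating all paths of length $L$ starting at $v$ (repeated vertices allowed) and merging them into a tree rooted at $v$, where occurrences of the same node on different paths are merged if they are at the same depth and all their ancestors are already merged. $\mathbb{T}=\{\mathcal{T}_v^L \mid v\in\mathcal{V}\}$ is regarded as a multiset indexed by nodes, so $|\mathbb{T}|=|\mathcal{V}|$. WL-embeddings: $\mathbf{a}_v^0=\mathbf{x}_v$ and $\mathbf{a}_v^{\ell}=\frac12\left(\mathbf{a}_v^{\ell-1}+\frac{1}{\deg(v)}\sum_{u\in\mathcal{N}(v)}w((v,u))\,\mathbf{a}_u^{\ell-1}\right)$,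 where $\mathcal{N}(v)$ is the set of neighbors of $v$, $\deg(v)=|\mathcal{N}(v)|$ and $w$ are edge weights ($w=1$ for unweighted graphs). The distance between computation trees is $d(\mathcal{T}_v^L,\mathcal{T}_u^L)=\|\mathbf{a}_v^L-\mathbf{a}_u^L\|_2$. $k\text{-NN}(\mathcal{T}_u^L)$ is the set of the $k$ nearest computation trees from $\mathbb{T}$ to $\mathcal{T}_u^L$ with respect to $d$ (a fixed choice, not depending on the sample $\mathbb{S}$). Reverse $k$-NN: $\text{Rev-}k\text{-NN}(\mathcal{T}_v^L)=\{\mathcal{T}_u^L\in\mathbb{T}\mid \mathcal{T}_v^L\in k\text{-NN}(\mathcal{T}_u^L)\}$. The representative power is $\Pi(\mathcal{T}_v^L)=|\text{Rev-}k\text{-NN}(\mathcal{T}_v^L)|/|\mathbb{T}|$. Sampled versions (with $k$-NN still computed relative to all of $\mathbb{T}$, and sampled trees counted with multiplicity): $\widetilde{\text{Rev-}k\text{-NN}}(\mathcal{T}_v^L)=\{\mathcal{T}_u^L\in\mathbb{S}\mid \mathcal{T}_v^L\in k\text{-NN}(\mathcal{T}_u^L)\}$ and $\widetilde{\Pi}(\mathcal{T}_v^L)=|\widetilde{\text{Rev-}k\text{-NN}}(\mathcal{T}_v^L)|/|\mathbb{S}|$. *)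

theory Defs
  imports "HOL-Probability.Probability" "HOL-Library.Multiset" "HOL-Library.Sublist"
begin

text \<open>
  Edges are ordered pairs; an undirected graph is one whose edge set is symmetric, and an
  unweighted graph is one whose weights are constantly 1. Neither is required here.
\<close>

record ('v, 'd :: finite) feature_graph =
  nodes :: "'v set"
  edges :: "('v \<times> 'v) set"
  feature :: "'v \<Rightarrow> real ^ 'd"
  weight :: "'v \<times> 'v \<Rightarrow> real"

definition wf_feature_graph :: "('v, 'd :: finite) feature_graph \<Rightarrow> bool" where
  "wf_feature_graph G \<longleftrightarrow>
     finite (nodes G) \<and> nodes G \<noteq> {} \<and> edges G \<subseteq> nodes G \<times> nodes G"

definition neighbors :: "('v, 'd :: finite) feature_graph \<Rightarrow> 'v \<Rightarrow> 'v set" where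
  "neighbors G v = {u. (v, u) \<in> edges G}"

definition deg :: "('v, 'd :: finite) feature_graph \<Rightarrow> 'v \<Rightarrow> nat" where
  "deg G v = card (neighbors G v)"

text \<open>
  A path of length \<open>L\<close> is a list of \<open>L + 1\<close> nodes, possibly with repetitions. Two occurrences of a
  node on paths from \<open>v\<close> are merged iff they have the same sequence of ancestors, so the vertices
  of the computation tree are the non-empty prefixes of these paths: the root is \<open>[v]\<close>, and the
  parent of a vertex \<open>q @ [u]\<close> with \<open>q \<noteq> []\<close> is \<open>q\<close>. The root is inserted explicitly because there
  may be no path of length \<open>L\<close> from \<open>v\<close> (for example if \<open>v\<close> is isolated).
\<close>

definition paths_from :: "('v, 'd :: finite) feature_graph \<Rightarrow> nat \<Rightarrow> 'v \<Rightarrow> 'v list set" where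
  "paths_from G L v =
     {p. length p = Suc L \<and> hd p = v \<and> successively (\<lambda>a b. (a, b) \<in> edges G) p}"

type_synonym 'v ctree = "'v list set"

definition comp_tree :: "('v, 'd :: finite) feature_graph \<Rightarrow> nat \<Rightarrow> 'v \<Rightarrow> 'v ctree" where
  "comp_tree G L v = insert [v] {q. q \<noteq> [] \<and> (\<exists>p \<in> paths_from G L v. prefix q p)}"

definition root_node :: "'v ctree \<Rightarrow> 'v" where
  "root_node t = (THE v. [v] \<in> t)"

lemma root_node_comp_tree: "root_node (comp_tree G L v) = v"
proof -
  have "w = v" if "[w] \<in> comp_tree G L v" for w
    using that by (auto simp: comp_tree_def paths_from_def prefix_def)
  moreover have "[v] \<in> comp_tree G L v"
    by (simp add: comp_tree_def)
  ultimately show ?thesis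
    unfolding root_node_def by (intro the_equality)
qed

text \<open>
  Tree vertices carry the names of graph nodes, so trees with different roots are different and
  this plain set coincides with the family of trees indexed by the nodes.
\<close>

definition comp_trees :: "('v, 'd :: finite) feature_graph \<Rightarrow> nat \<Rightarrow> 'v ctree set" where
  "comp_trees G L = comp_tree G L ` nodes G"

lemma inj_comp_tree: "inj (comp_tree G L)"
  by (metis injI root_node_comp_tree)

lemma card_comp_trees: "card (comp_trees G L) = card (nodes G)"
  unfolding comp_trees_def by (meson card_image inj_comp_tree inj_on_subset subset_UNIV)

text \<open>For a node without neighbors the averaged sum below is the zero vector.\<close>

primrec wl_embedding ::
  "('v, 'd :: finite) feature_graph \<Rightarrow> nat \<Rightarrow> 'v \<Rightarrow> real ^ 'd" where
  "wl_embedding G 0 v = feature G v"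
| "wl_embedding G (Suc l) v =
     (1 / 2) *\<^sub>R (wl_embedding G l v +
       (1 / real (deg G v)) *\<^sub>R
         (\<Sum>u \<in> neighbors G v. weight G (v, u) *\<^sub>R wl_embedding G l u))"

definition tree_dist ::
  "('v, 'd :: finite) feature_graph \<Rightarrow> nat \<Rightarrow> 'v ctree \<Rightarrow> 'v ctree \<Rightarrow> real" where
  "tree_dist G L t s =
     norm (wl_embedding G L (root_node t) - wl_embedding G L (root_node s))"

text \<open>
  With ties in distance there are several sets of \<open>k\<close> nearest trees; \<open>knn\<close> is any function that
  selects one of them for every tree. A tree belongs to its own candidate set. If there
  are fewer than \<open>k\<close> trees, all of them are selected.
\<close>

definition knn_choice ::
  "('v, 'd :: finite) feature_graph \<Rightarrow> nat \<Rightarrow> nat \<Rightarrow> ('v ctree \<Rightarrow> 'v ctree set) \<Rightarrow> bool" where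
  "knn_choice G L k knn \<longleftrightarrow>
     (\<forall>t \<in> comp_trees G L.
        knn t \<subseteq> comp_trees G L \<and>
        card (knn t) = min k (card (comp_trees G L)) \<and>
        (\<forall>s \<in> knn t. \<forall>s' \<in> comp_trees G L - knn t. tree_dist G L t s \<le> tree_dist G L t s'))"

definition rev_knn :: "'t set \<Rightarrow> ('t \<Rightarrow> 't set) \<Rightarrow> 't \<Rightarrow> 't set" where
  "rev_knn T knn t = {s \<in> T. t \<in> knn s}"

definition rep_power :: "'t set \<Rightarrow> ('t \<Rightarrow> 't set) \<Rightarrow> 't \<Rightarrow> real" where
  "rep_power T knn t = real (card (rev_knn T knn t)) / real (card T)"

definition sampled_rev_knn :: "'t multiset \<Rightarrow> ('t \<Rightarrow> 't set) \<Rightarrow> 't \<Rightarrow> 't multiset" where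
  "sampled_rev_knn S knn t = {#s \<in># S. t \<in> knn s#}"

definition sampled_rep_power :: "'t multiset \<Rightarrow> ('t \<Rightarrow> 't set) \<Rightarrow> 't \<Rightarrow> real" where
  "sampled_rep_power S knn t = real (size (sampled_rev_knn S knn t)) / real (size S)"

text \<open>\<open>X i\<close> is the \<open>i\<close>-th draw; the sample is the multiset of the \<open>n\<close> draws.\<close>

definition iid_uniform_draws ::
  "'a measure \<Rightarrow> 't set \<Rightarrow> nat \<Rightarrow> (nat \<Rightarrow> 'a \<Rightarrow> 't) \<Rightarrow> bool" where
  "iid_uniform_draws M T n X \<longleftrightarrow>
     prob_space.indep_vars M (\<lambda>_. count_space T) X {..<n} \<and>
     (\<forall>i<n. distr M (count_space T) (X i) = uniform_count_measure T)"

definition sample :: "nat \<Rightarrow> (nat \<Rightarrow> 'a \<Rightarrow> 't) \<Rightarrow> 'a \<Rightarrow> 't multiset" where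
  "sample n X \<omega> = {#X i \<omega>. i \<in># mset_set {..<n}#}"

end

(*
  The sampled representative power is the average of n independent Bernoulli variables with mean
  the true representative power, so Hoeffding's inequality bounds the failure probability by
  2 exp (-2 n \<theta>\<^sup>2). Since n \<theta>\<^sup>2 \<ge> (2 + \<theta>) ln (2 / \<delta>) \<ge> ln (2 / \<delta>), this is at most \<delta>.
*)
theory Submission
  imports Defs "HOL-Probability.Hoeffding"
begin

text \<open>Filtering commutes with taking the image multiset, so counting sampled trees with
  multiplicity becomes counting draw indices. This exhibits the sampled power as an empirical mean
  of indicators, the form Hoeffding's inequality expects.\<close>

lemma sampled_rep_power_sample:
  "sampled_rep_power (sample n X \<omega>) knn t
     = (\<Sum>i<n. indicator {s. t \<in> knn s} (X i \<omega>)) / real n"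
proof -
  have "size (sampled_rev_knn (sample n X \<omega>) knn t) = card {i \<in> {..<n}. t \<in> knn (X i \<omega>)}"
    by (simp add: sampled_rev_knn_def sample_def filter_mset_image_mset)
  also have "real \<dots> = (\<Sum>i<n. indicator {s. t \<in> knn s} (X i \<omega>))"
    by (simp add: indicator_def sum.If_cases Int_def)
  finally show ?thesis
    by (simp add: sampled_rep_power_def sample_def)
qed

text \<open>The function \<open>knn\<close> is fixed before sampling, so membership of
  \<open>t\<close> in \<open>knn (X i \<omega>)\<close> depends on the single draw
  \<open>X i\<close> only; the indicators therefore inherit independence and a common law from the
  draws.\<close>

lemma (in prob_space) sampled_rep_power_deviation:
  fixes \<epsilon> :: real
  assumes "finite T" "iid_uniform_draws M T n X" "n > 0" "\<epsilon> \<ge> 0"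
  shows "prob {\<omega> \<in> space M. \<bar>sampled_rep_power (sample n X \<omega>) knn t - rep_power T knn t\<bar> \<ge> \<epsilon>}
           \<le> 2 * exp (- 2 * real n * \<epsilon>\<^sup>2)"
    and "(\<lambda>\<omega>. sampled_rep_power (sample n X \<omega>) knn t) \<in> borel_measurable M"
proof -
  define f :: "'b \<Rightarrow> real" where "f = indicator {s. t \<in> knn s}"
  have indep: "indep_vars (\<lambda>_. count_space T) X {..<n}"
    and distr: "\<And>i. i < n \<Longrightarrow> distr M (count_space T) (X i) = uniform_count_measure T"
    using assms(2) by (auto simp: iid_uniform_draws_def)
  have X: "X i \<in> M \<rightarrow>\<^sub>M count_space T" if "i < n" for i
    using indep that by (auto simp: indep_vars_def)
  have f: "f \<in> borel_measurable (count_space T)"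
    by simp
  have fX: "(\<lambda>\<omega>. f (X i \<omega>)) \<in> borel_measurable M" if "i < n" for i
    using X[OF that] by (rule measurable_compose) simp
  \<comment> \<open>Both laws are the pushforward under \<open>f\<close> of the uniform measure on
    \<open>T\<close>. Draw 0, which exists because \<open>n > 0\<close>, serves as the reference
    variable.\<close>
  have dist: "distr M borel (\<lambda>\<omega>. f (X i \<omega>)) = distr M borel (\<lambda>\<omega>. f (X 0 \<omega>))" if "i < n" for i
    using distr_distr[OF f X[OF that]] distr_distr[OF f X[OF \<open>n > 0\<close>]]
      distr[OF that] distr[OF \<open>n > 0\<close>] by (simp add: comp_def)
  have mean: "rep_power T knn t = expectation (\<lambda>\<omega>. f (X 0 \<omega>))"
  proof -
    have "expectation (\<lambda>\<omega>. f (X 0 \<omega>)) = integral\<^sup>L (uniform_count_measure T) f"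
      using integral_distr[OF X[OF \<open>n > 0\<close>] f] distr[OF \<open>n > 0\<close>] by simp
    also have "\<dots> = (\<Sum>s\<in>T. f s) / card T"
      using \<open>finite T\<close> by (rule integral_uniform_count_measure)
    also have "(\<Sum>s\<in>T. f s) = card {s \<in> T. t \<in> knn s}"
      using \<open>finite T\<close> by (simp add: f_def indicator_def sum.If_cases Int_def)
    finally show ?thesis
      by (simp add: rep_power_def rev_knn_def)
  qed
  \<comment> \<open>The indicators take values in an interval of width 1, so no width factor remains
    in the exponent of the bound.\<close>
  interpret Hoeffding_ineq_iid M "{..<n}" "\<lambda>i \<omega>. f (X i \<omega>)" "\<lambda>\<omega>. f (X 0 \<omega>)" 0 1 "rep_power T knn t"
  proof unfold_locales
    show "indep_vars (\<lambda>_. borel) (\<lambda>i \<omega>. f (X i \<omega>)) {..<n}"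
      using indep by (rule indep_vars_compose2) simp
    show "rep_power T knn t \<equiv> expectation (\<lambda>\<omega>. f (X 0 \<omega>))"
      using mean by simp
    show "distr M borel (\<lambda>\<omega>. f (X i \<omega>)) = distr M borel (\<lambda>\<omega>. f (X 0 \<omega>))" if "i \<in> {..<n}" for i
      using that by (intro dist) simp
    show "AE \<omega> in M. f (X 0 \<omega>) \<in> {0..1}"
      by (simp add: f_def indicator_def)
    show "random_variable borel (\<lambda>\<omega>. f (X 0 \<omega>))"
      using \<open>n > 0\<close> by (rule fX)
  qed simp
  show "prob {\<omega> \<in> space M. \<bar>sampled_rep_power (sample n X \<omega>) knn t - rep_power T knn t\<bar> \<ge> \<epsilon>}
          \<le> 2 * exp (- 2 * real n * \<epsilon>\<^sup>2)"
    using Hoeffding_ineq_abs_ge'[OF \<open>\<epsilon> \<ge> 0\<close>] \<open>n > 0\<close>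
    by (simp add: sampled_rep_power_sample f_def lessThan_empty_iff)
  show "(\<lambda>\<omega>. sampled_rep_power (sample n X \<omega>) knn t) \<in> borel_measurable M"
    using fX unfolding sampled_rep_power_sample f_def[symmetric] by measurable
qed

theorem lemma1:
  fixes G :: "('v, 'd :: finite) feature_graph"
    and L k n :: nat
    and knn :: "'v ctree \<Rightarrow> 'v ctree set"
    and \<theta> \<delta> :: real
    and M :: "'a measure"
    and X :: "nat \<Rightarrow> 'a \<Rightarrow> 'v ctree"
    and v :: 'v
  assumes "wf_feature_graph G"
    and "L \<ge> 1"
    and "k \<ge> 1"
    and "knn_choice G L k knn"
    and "\<theta> > 0"
    and "0 < \<delta>" and "\<delta> < 1"
    and "prob_space M"
    and "iid_uniform_draws M (comp_trees G L) n X"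
    and "real n \<ge> ln (2 / \<delta>) * (2 + \<theta>) / \<theta>\<^sup>2"
    and "v \<in> nodes G"
  shows "measure M {\<omega> \<in> space M.
           \<bar>sampled_rep_power (sample n X \<omega>) knn (comp_tree G L v)
             - rep_power (comp_trees G L) knn (comp_tree G L v)\<bar> \<le> \<theta>} \<ge> 1 - \<delta>"
proof -
  interpret prob_space M by fact
  let ?T = "comp_trees G L"
  let ?D = "\<lambda>\<omega>. \<bar>sampled_rep_power (sample n X \<omega>) knn (comp_tree G L v)
                    - rep_power ?T knn (comp_tree G L v)\<bar>"
  have "finite ?T"
    using assms(1) by (simp add: comp_trees_def wf_feature_graph_def)
  have ln_pos: "ln (2 / \<delta>) > 0"
    using assms by simp
  have "real n * \<theta>\<^sup>2 \<ge> ln (2 / \<delta>) * (2 + \<theta>)"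
    using assms by (simp add: field_simps)
  moreover have "ln (2 / \<delta>) * (2 + \<theta>) > ln (2 / \<delta>)"
    using ln_pos \<open>\<theta> > 0\<close> by simp
  ultimately have n\<theta>: "real n * \<theta>\<^sup>2 > ln (2 / \<delta>)"
    by linarith
  then have exponent: "- 2 * real n * \<theta>\<^sup>2 \<le> - ln (2 / \<delta>)"
    using ln_pos by simp
  \<comment> \<open>For \<open>n = 0\<close> the product \<open>real n * \<theta>\<^sup>2\<close>
    would vanish, yet it exceeds the positive number \<open>ln (2 / \<delta>)\<close>.\<close>
  have "n > 0"
    using n\<theta> ln_pos by (intro Nat.gr0I) auto
  note bound = sampled_rep_power_deviation
    [OF \<open>finite ?T\<close> assms(9) \<open>n > 0\<close> less_imp_le[OF \<open>\<theta> > 0\<close>], of knn "comp_tree G L v"]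
  note [measurable] = bound(2)
  have "exp (- 2 * real n * \<theta>\<^sup>2) \<le> exp (- ln (2 / \<delta>))"
    using exponent by simp
  also have "\<dots> = \<delta> / 2"
    using \<open>0 < \<delta>\<close> by (simp add: exp_minus)
  \<comment> \<open>The 2 inside the logarithm absorbs the factor 2 of the two-sided tail
    bound.\<close>
  finally have fail: "prob {\<omega> \<in> space M. ?D \<omega> \<ge> \<theta>} \<le> \<delta>"
    using bound(1) by linarith
  \<comment> \<open>The failure event includes the boundary case of deviation exactly
    \<open>\<theta>\<close>, so its complement is the strict event, which lies inside the desired
    one.\<close>
  have "1 - prob {\<omega> \<in> space M. ?D \<omega> \<ge> \<theta>} = prob (space M - {\<omega> \<in> space M. ?D \<omega> \<ge> \<theta>})"
    by (rule prob_compl[symmetric]) measurable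
  also have "\<dots> \<le> prob {\<omega> \<in> space M. ?D \<omega> \<le> \<theta>}"
    by (rule finite_measure_mono) auto
  finally show ?thesis
    using fail by linarith
qed

end
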